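(* Let $h:\mathbb{R}^d\to\mathbb{R}$ be differentiable with $L_{\nabla h}$-Lipschitz continuous gradient, let $g:\mathbb{R}^n\to\mathbb{R}$ be $\rho$-weakly convex with $\rho>0$ and $L_g$-Lipschitz continuous, and let $A\in\mathbb{R}^{n\times d}$ be nonzero. Consider minimizing $h(x)+g(Ax)$ over $x\in\mathbb{R}^d$ with the algorithm "Variable Smoothing with Epochs" (described in the context) started at $x_1\in\mathbb{R}^d$, and assume that $F^*:=\liminf_{k\to\infty}F_k(x_k)$ is finite. Then, for a given tolerance $\epsilon>0$, the algorithm generates an iterate $x_j$ for some $j=O(\epsilon^{-3})$ such that $$\operatorname{dist}\big(-\nabla h(x_j),\,A^*\partial g(z_j)\big)\le\epsilon\quad\text{and}\quad\|Ax_j-z_j\|\le\epsilon,$$ where $z_j=\operatorname{prox}_{\mu_j g}(Ax_j)$.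
   Context: Norms are Euclidean and $\|A\|$ is the operator norm; $A^*$ is the transpose (adjoint) of $A$. A function $g$ is $\rho$-weakly convex if $g+\frac{\rho}{2}\|\cdot\|^2$ is convex. For $\mu\in(0,\rho^{-1})$, $$g_\mu(y)=\inf_{z\in\mathbb{R}^n}\Big\{g(z)+\tfrac{1}{2\mu}\|z-y\|^2\Big\},\qquad \operatorname{prox}_{\mu g}(y)=\operatorname*{arg\,min}_{z\in\mathbb{R}^n}\Big\{g(z)+\tfrac{1}{2\mu}\|z-y\|^2\Big\};$$ the minimizer is unique, and $g_\mu$ is continuously differentiable with $\nabla g_\mu(y)=\frac1\mu(y-\operatorname{prox}_{\mu g}(y))$. The symbol $\partial g(\bar y)$ denotes the Fréchet subdifferential: the set of $v$ with $g(y)\ge g(\bar y)+\langle v,y-\bar y\rangle+o(\|y-\bar y\|)$ as $y\to\bar y$. For a set $S\subset\mathbb{R}^n$, $A^*S=\{A^*v: v\in S\}$, and $\operatorname{dist}(x,\mathcal{A})=\inf_{y\in\mathcal{A}}\|x-y\|$. Algorithm (Variable Smoothing with Epochs). Put $\mu_k=(2\rho)^{-1}k^{-1/3}$, $F_k(x)=h(x)+g_{\mu_k}(Ax)$, $L_k=L_{\nabla h}+\|A\|^2/\mu_k$, $\gamma_k=1/L_k$. Input: $x_1\in\mathbb{R}^d$ and $\epsilon>0$. For epochs $l=0,1,2,\dots$: set $S_l\leftarrow\infty$ and $j_l\leftarrow 2^l$; for $k=2^l,2^l+1,\dots,2^{l+1}-1$: set $x_{k+1}\leftarrow x_k-\gamma_k\nabla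 F_k(x_k)$; if $\|\nabla F_{k+1}(x_{k+1})\|\le S_l$, then set $S_l\leftarrow\|\nabla F_{k+1}(x_{k+1})\|$, $j_l\leftarrow k+1$, and if moreover $S_l\le\epsilon$ and $\|Ax_{k+1}-\operatorname{prox}_{\mu_{k+1}g}(Ax_{k+1})\|\le\epsilon$, STOP. The recursion for $x_k$ does not depend on $\epsilon$ or on the stopping test; $F^*$ is computed along the infinite sequence $(x_k)$ defined by this recursion. The notation $j=O(\epsilon^{-3})$ is for $\epsilon\to0$, with a constant independent of $\epsilon$ (it may depend on $h,g,A,\rho,L_{\nabla h},L_g,x_1,F^*$). *)

theory Defs
  imports "HOL-Analysis.Analysis" "HOL-Library.Landau_Symbols"
begin

definition weakly_convex :: "real \<Rightarrow> ('a::real_inner \<Rightarrow> real) \<Rightarrow> bool" where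
  "weakly_convex \<rho> g \<longleftrightarrow> convex_on UNIV (\<lambda>y. g y + \<rho> / 2 * (norm y)\<^sup>2)"

(* Meaningful only where f is differentiable; there the vector is unique. *)
definition grad :: "('a::real_inner \<Rightarrow> real) \<Rightarrow> 'a \<Rightarrow> 'a" where
  "grad f x = (THE v. GDERIV f x :> v)"

(* The infimum and the minimizer below are meaningful when g is rho-weakly convex
   and 0 < mu < 1 / rho: then the function of z is bounded below and has a unique
   minimizer. *)
definition moreau_env :: "real \<Rightarrow> ('a::real_inner \<Rightarrow> real) \<Rightarrow> 'a \<Rightarrow> real" where
  "moreau_env \<mu> g y = (INF z. g z + 1 / (2 * \<mu>) * (norm (z - y))\<^sup>2)"

definition prox :: "real \<Rightarrow> ('a::real_inner \<Rightarrow> real) \<Rightarrow> 'a \<Rightarrow> 'a" where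
  "prox \<mu> g y = (ARG_MIN (\<lambda>z. g z + 1 / (2 * \<mu>) * (norm (z - y))\<^sup>2) z. True)"

definition frechet_subdiff :: "('a::real_inner \<Rightarrow> real) \<Rightarrow> 'a \<Rightarrow> 'a set" where
  "frechet_subdiff g y0 =
     {v. \<exists>r \<in> o[at y0](\<lambda>y. norm (y - y0)).
           \<forall>\<^sub>F y in at y0. g y \<ge> g y0 + v \<bullet> (y - y0) + r y}"

(* Extended-real valued, so that the distance to the empty set is infinite;
   infdist would give 0 there. *)
definition edist_to :: "'a::metric_space \<Rightarrow> 'a set \<Rightarrow> ereal" where
  "edist_to x S = (INF y\<in>S. ereal (dist x y))"

definition vs_mu :: "real \<Rightarrow> nat \<Rightarrow> real" where
  "vs_mu \<rho> k = 1 / (2 * \<rho>) * real k powr (- 1 / 3)"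

definition vs_F ::
  "(real^'d \<Rightarrow> real) \<Rightarrow> (real^'n \<Rightarrow> real) \<Rightarrow> real^'d^'n \<Rightarrow> real \<Rightarrow> nat \<Rightarrow> real^'d \<Rightarrow> real" where
  "vs_F h g A \<rho> k x = h x + moreau_env (vs_mu \<rho> k) g (A *v x)"

definition vs_L :: "real^'d^'n \<Rightarrow> real \<Rightarrow> real \<Rightarrow> nat \<Rightarrow> real" where
  "vs_L A \<rho> Lh k = Lh + (onorm ((*v) A))\<^sup>2 / vs_mu \<rho> k"

definition vs_gamma :: "real^'d^'n \<Rightarrow> real \<Rightarrow> real \<Rightarrow> nat \<Rightarrow> real" where
  "vs_gamma A \<rho> Lh k = 1 / vs_L A \<rho> Lh k"

(* The iterates x_1, x_2, ..., not interrupted by the stopping test. The value at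
   index 0 is a dummy. *)
fun vs_iter ::
  "(real^'d \<Rightarrow> real) \<Rightarrow> (real^'n \<Rightarrow> real) \<Rightarrow> real^'d^'n \<Rightarrow> real \<Rightarrow> real \<Rightarrow> real^'d \<Rightarrow> nat \<Rightarrow> real^'d" where
  "vs_iter h g A \<rho> Lh x1 0 = x1"
| "vs_iter h g A \<rho> Lh x1 (Suc 0) = x1"
| "vs_iter h g A \<rho> Lh x1 (Suc (Suc m)) =
     (let k = Suc m; x = vs_iter h g A \<rho> Lh x1 k
      in x - vs_gamma A \<rho> Lh k *\<^sub>R grad (vs_F h g A \<rho> k) x)"

(* Execution of the algorithm with epochs on tolerance eps.
   vs_run h g A rho Lh x1 eps l k S j stopped: the run reaches a state in epoch l in
   which x_k is the last iterate computed (x_1 initially), S and j are the values of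
   S_l and j_l, and stopped says whether STOP has been executed. A stopped state has
   no successor. *)
inductive vs_run ::
  "(real^'d \<Rightarrow> real) \<Rightarrow> (real^'n \<Rightarrow> real) \<Rightarrow> real^'d^'n \<Rightarrow> real \<Rightarrow> real \<Rightarrow> real^'d \<Rightarrow> real
     \<Rightarrow> nat \<Rightarrow> nat \<Rightarrow> ereal \<Rightarrow> nat \<Rightarrow> bool \<Rightarrow> bool"
  for h g A \<rho> Lh x1 \<epsilon> where
  start: "vs_run h g A \<rho> Lh x1 \<epsilon> 0 1 \<infinity> 1 False"
| next_epoch:
    "vs_run h g A \<rho> Lh x1 \<epsilon> l k S j False \<Longrightarrow> k = 2 ^ (l + 1) \<Longrightarrow>
     vs_run h g A \<rho> Lh x1 \<epsilon> (l + 1) k \<infinity> (2 ^ (l + 1)) False"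
| improve:
    "vs_run h g A \<rho> Lh x1 \<epsilon> l k S j False \<Longrightarrow> k < 2 ^ (l + 1) \<Longrightarrow>
     x' = vs_iter h g A \<rho> Lh x1 (k + 1) \<Longrightarrow>
     N = norm (grad (vs_F h g A \<rho> (k + 1)) x') \<Longrightarrow>
     ereal N \<le> S \<Longrightarrow>
     stop = (N \<le> \<epsilon> \<and> norm (A *v x' - prox (vs_mu \<rho> (k + 1)) g (A *v x')) \<le> \<epsilon>) \<Longrightarrow>
     vs_run h g A \<rho> Lh x1 \<epsilon> l (k + 1) (ereal N) (k + 1) stop"
| no_improve:
    "vs_run h g A \<rho> Lh x1 \<epsilon> l k S j False \<Longrightarrow> k < 2 ^ (l + 1) \<Longrightarrow>
     x' = vs_iter h g A \<rho> Lh x1 (k + 1) \<Longrightarrow>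
     N = norm (grad (vs_F h g A \<rho> (k + 1)) x') \<Longrightarrow>
     \<not> ereal N \<le> S \<Longrightarrow>
     vs_run h g A \<rho> Lh x1 \<epsilon> l (k + 1) S j False"

(* The k-th iterate is produced no later than the moment the algorithm stops. *)
definition vs_generates ::
  "(real^'d \<Rightarrow> real) \<Rightarrow> (real^'n \<Rightarrow> real) \<Rightarrow> real^'d^'n \<Rightarrow> real \<Rightarrow> real \<Rightarrow> real^'d \<Rightarrow> real
     \<Rightarrow> nat \<Rightarrow> bool" where
  "vs_generates h g A \<rho> Lh x1 \<epsilon> k \<longleftrightarrow>
     (\<exists>l S j stopped. vs_run h g A \<rho> Lh x1 \<epsilon> l k S j stopped)"

end

theory Submission
  imports Defs
begin

text \<open>Comparing the values of the proximal objective at suitable points shows that the Moreau envelope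
  \<open>g\<^sub>\<mu>\<close> lies below a parabola of curvature \<open>1/\<mu>\<close> at every point, that \<open>(y - prox y)/\<mu>\<close> is
  both its gradient and a Frechet subgradient of \<open>g\<close> at \<open>prox y\<close>, and that \<open>\<parallel>y - prox y\<parallel> \<le> 2\<mu>L\<^sub>g\<close>. Hence
  a gradient step decreases \<open>F\<^sub>k\<close> by \<open>\<gamma>\<^sub>k/2 \<parallel>\<nabla>F\<^sub>k\<parallel>\<^sup>2\<close>, while passing from \<open>\<mu>\<^sub>k\<close> to the next parameter
  costs at most a telescoping term. On a block \<open>[K, 2K)\<close> the step sizes add up to order \<open>K\<close> to the power
  \<open>2/3\<close>, so a block without an iterate of gradient norm at most \<open>\<epsilon>\<close> has \<open>K = O(1/\<epsilon>^3)\<close>; the bound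
  \<open>2\<mu>\<^sub>kL\<^sub>g\<close> on the distance to the proximal point also drops below \<open>\<epsilon>\<close> for \<open>k\<close> of that order.\<close>

section \<open>Gradients\<close>

lemma GDERIV_unique:
  assumes "GDERIV f x :> v" and "GDERIV f x :> w"
  shows "v = w"
proof -
  have "(\<lambda>h. h \<bullet> v) = (\<lambda>h. h \<bullet> w)"
    using has_derivative_unique assms unfolding gderiv_def by blast
  then have "(v - w) \<bullet> v = (v - w) \<bullet> w"
    by metis
  then show ?thesis
    by (metis inner_diff_right inner_eq_zero_iff right_minus_eq)
qed

lemma grad_eqI: "GDERIV f x :> v \<Longrightarrow> grad f x = v"
  unfolding grad_def using GDERIV_unique by blast

text \<open>In finite dimension the derivative \<open>D\<close> is the inner product with
  \<open>adjoint D 1\<close>, so \<open>grad\<close> denotes an actual gradient.\<close>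

lemma GDERIV_grad:
  fixes f :: "'a::euclidean_space \<Rightarrow> real"
  assumes "f differentiable (at x)"
  shows "GDERIV f x :> grad f x"
proof -
  obtain D where D: "(f has_derivative D) (at x)"
    using assms unfolding differentiable_def by blast
  have "linear D"
    using D has_derivative_linear by blast
  then have "D = (\<lambda>h. h \<bullet> adjoint D 1)"
    by (simp add: fun_eq_iff adjoint_works)
  then have "GDERIV f x :> adjoint D 1"
    using D by (simp add: gderiv_def)
  then show ?thesis
    by (simp add: grad_eqI)
qed

text \<open>A quadratic remainder is of smaller order than \<open>norm (y - x)\<close>, so two-sided
  parabola bounds suffice for differentiability.\<close>

lemma GDERIV_quadratic_bound:
  fixes f :: "'a::real_inner \<Rightarrow> real"
  assumes "\<And>y. \<bar>f y - f x - (y - x) \<bullet> v\<bar> \<le> K * (norm (y - x))\<^sup>2"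
  shows "GDERIV f x :> v"
  unfolding gderiv_def
proof (rule has_derivativeI_sandwich[where e=1 and H="\<lambda>y. K * norm (y - x)"])
  show "norm (f y - f x - (y - x) \<bullet> v) / norm (y - x) \<le> K * norm (y - x)"
    if "y \<noteq> x" for y
    using assms[of y] that by (simp add: field_simps power2_eq_square)
  have "((\<lambda>y. K * norm (y - x)) \<longlongrightarrow> K * norm (x - x)) (at x)"
    by (intro tendsto_intros)
  then show "((\<lambda>y. K * norm (y - x)) \<longlongrightarrow> 0) (at x)"
    by simp
qed (auto simp: bounded_linear_inner_left)

text \<open>On the segment from \<open>x\<close> to \<open>y\<close>, \<open>\<psi>\<close> is
  \<open>f\<close> minus the linear and quadratic terms of the bound; its derivative is nonpositive
  by Cauchy-Schwarz and the Lipschitz bound on \<open>G\<close>.\<close>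

lemma descent_lemma:
  fixes f :: "'a::real_inner \<Rightarrow> real"
  assumes G: "\<And>u. GDERIV f u :> G u" and lip: "L-lipschitz_on UNIV G"
  shows "f y \<le> f x + G x \<bullet> (y - x) + L / 2 * (norm (y - x))\<^sup>2"
proof -
  define v where "v = y - x"
  define \<psi> where
    "\<psi> t = f (x + t *\<^sub>R v) - t * (G x \<bullet> v) - L / 2 * t\<^sup>2 * (norm v)\<^sup>2" for t
  have "\<psi> 1 \<le> \<psi> 0"
  proof (rule DERIV_nonpos_imp_nonincreasing[where f=\<psi>])
    fix t :: real
    assume t: "0 \<le> t" "t \<le> 1"
    let ?D = "G (x + t *\<^sub>R v) \<bullet> v - G x \<bullet> v - L * t * (norm v)\<^sup>2"
    have "((\<lambda>s. f (x + s *\<^sub>R v)) has_derivative (\<lambda>s. (s *\<^sub>R v) \<bullet> G (x + t *\<^sub>R v))) (at t)"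
    proof (rule has_derivative_compose[where g=f and f="\<lambda>s. x + s *\<^sub>R v"])
      show "((\<lambda>s. x + s *\<^sub>R v) has_derivative (\<lambda>s. s *\<^sub>R v)) (at t)"
        by (auto intro!: derivative_eq_intros)
      show "(f has_derivative (\<lambda>h. h \<bullet> G (x + t *\<^sub>R v))) (at (x + t *\<^sub>R v))"
        using G unfolding gderiv_def .
    qed
    then have "((\<lambda>s. f (x + s *\<^sub>R v)) has_real_derivative (G (x + t *\<^sub>R v) \<bullet> v)) (at t)"
      by (simp add: has_field_derivative_def inner_commute mult_commute_abs)
    then have D: "(\<psi> has_real_derivative ?D) (at t)"
      unfolding \<psi>_def by (auto intro!: derivative_eq_intros)
    have "norm (G (x + t *\<^sub>R v) - G x) \<le> L * (t * norm v)"
      using lipschitz_onD[OF lip, of "x + t *\<^sub>R v" x] t by (simp add: dist_norm)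
    then have "(G (x + t *\<^sub>R v) - G x) \<bullet> v \<le> L * (t * norm v) * norm v"
      by (meson norm_cauchy_schwarz mult_right_mono norm_ge_zero order_trans)
    then have "?D \<le> 0"
      by (simp add: inner_diff_left power2_eq_square mult.assoc)
    with D show "\<exists>d. (\<psi> has_real_derivative d) (at t) \<and> d \<le> 0"
      by blast
  qed simp
  then show ?thesis
    by (simp add: \<psi>_def v_def)
qed

section \<open>The proximal map and the Moreau envelope\<close>

abbreviation prox_fun :: "real \<Rightarrow> ('a::real_inner \<Rightarrow> real) \<Rightarrow> 'a \<Rightarrow> 'a \<Rightarrow> real" where
  "prox_fun \<mu> g y z \<equiv> g z + 1 / (2 * \<mu>) * (norm (z - y))\<^sup>2"

text \<open>Outside the ball of radius \<open>2 * \<mu> * L\<close> the quadratic term outweighs any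
  decrease of \<open>g\<close>, so a minimizer over this compact ball is global.\<close>

lemma prox_fun_has_minimizer:
  fixes g :: "'a::euclidean_space \<Rightarrow> real"
  assumes lip: "L-lipschitz_on UNIV g" and \<mu>: "0 < \<mu>"
  shows "\<exists>p. \<forall>z. prox_fun \<mu> g y p \<le> prox_fun \<mu> g y z"
proof -
  have L: "0 \<le> L"
    using lip lipschitz_on_nonneg by blast
  have cont: "continuous_on (cball y (2 * \<mu> * L)) (prox_fun \<mu> g y)"
    by (intro continuous_intros continuous_on_subset[OF lipschitz_on_continuous_on[OF lip]]) simp
  have y: "y \<in> cball y (2 * \<mu> * L)"
    using L \<mu> by simp
  obtain p where p: "\<And>z. z \<in> cball y (2 * \<mu> * L) \<Longrightarrow> prox_fun \<mu> g y p \<le> prox_fun \<mu> g y z"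
    using continuous_attains_inf[OF compact_cball _ cont] y by blast
  have "prox_fun \<mu> g y p \<le> prox_fun \<mu> g y z" if "z \<notin> cball y (2 * \<mu> * L)" for z
  proof -
    have n: "2 * \<mu> * L \<le> norm (z - y)"
      using that by (simp add: dist_norm norm_minus_commute)
    have "2 * \<mu> * L * norm (z - y) \<le> norm (z - y) * norm (z - y)"
      using n by (rule mult_right_mono) simp
    then have "L * norm (z - y) \<le> 1 / (2 * \<mu>) * (norm (z - y))\<^sup>2"
      using \<mu> by (simp add: field_simps power2_eq_square)
    moreover have "g y - g z \<le> L * norm (z - y)"
      using lipschitz_onD[OF lip, of y z] by (simp add: dist_norm norm_minus_commute)
    ultimately have "prox_fun \<mu> g y y \<le> prox_fun \<mu> g y z"
      by simp
    then show ?thesis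
      using p[OF y] by linarith
  qed
  then show ?thesis
    using p by blast
qed

context
  fixes g :: "'a::euclidean_space \<Rightarrow> real" and L \<mu> :: real
  assumes lip: "L-lipschitz_on UNIV g" and \<mu>_pos: "0 < \<mu>"
begin

lemma prox_minimizes: "prox_fun \<mu> g y (prox \<mu> g y) \<le> prox_fun \<mu> g y z"
proof -
  obtain p where "\<forall>z. prox_fun \<mu> g y p \<le> prox_fun \<mu> g y z"
    using prox_fun_has_minimizer[OF lip \<mu>_pos] by blast
  then show ?thesis
    unfolding prox_def by (rule_tac arg_minI[where x=p]) (auto simp: not_less)
qed

lemma moreau_env_eq: "moreau_env \<mu> g y = prox_fun \<mu> g y (prox \<mu> g y)"
  unfolding moreau_env_def
  using prox_minimizes by (intro cInf_eq_minimum) auto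

lemma moreau_env_le: "moreau_env \<mu> g y \<le> prox_fun \<mu> g y z"
  using prox_minimizes moreau_env_eq by simp

text \<open>Testing minimality against \<open>y\<close> itself bounds the quadratic term by a
  difference of values of \<open>g\<close>, hence by \<open>L\<close> times the distance; one factor
  of the distance cancels.\<close>

lemma norm_prox_diff_le: "norm (y - prox \<mu> g y) \<le> 2 * \<mu> * L"
proof -
  let ?d = "norm (y - prox \<mu> g y)"
  have "1 / (2 * \<mu>) * ?d\<^sup>2 \<le> g y - g (prox \<mu> g y)"
    using prox_minimizes[of y y] by (simp add: norm_minus_commute)
  also have "\<dots> \<le> L * ?d"
    using lipschitz_onD[OF lip, of y "prox \<mu> g y"] by (simp add: dist_norm)
  finally have "?d * ?d \<le> 2 * \<mu> * L * ?d"
    using \<mu>_pos by (simp add: field_simps power2_eq_square)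
  then show ?thesis
    using lipschitz_on_nonneg[OF lip] \<mu>_pos
    by (cases "?d = 0") (auto simp: mult_le_cancel_right)
qed

text \<open>Minimality puts a concave parabola below \<open>g\<close> that touches it at the
  proximal point; its slope there is the subgradient and its quadratic part is the remainder
  \<open>?r\<close>.\<close>

lemma prox_subgradient:
  "(1 / \<mu>) *\<^sub>R (y - prox \<mu> g y) \<in> frechet_subdiff g (prox \<mu> g y)"
proof -
  let ?p = "prox \<mu> g y" and ?r = "\<lambda>z. - (1 / (2 * \<mu>)) * (norm (z - prox \<mu> g y))\<^sup>2"
  have "?r \<in> o[at ?p](\<lambda>z. norm (z - ?p))"
  proof (rule smalloI_tendsto)
    have "((\<lambda>z. - (1 / (2 * \<mu>)) * norm (z - ?p)) \<longlongrightarrow> - (1 / (2 * \<mu>)) * norm (?p - ?p)) (at ?p)"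
      by (intro tendsto_intros)
    then have "((\<lambda>z. - (1 / (2 * \<mu>)) * norm (z - ?p)) \<longlongrightarrow> 0) (at ?p)"
      by simp
    then show "((\<lambda>z. ?r z / norm (z - ?p)) \<longlongrightarrow> 0) (at ?p)"
      by (rule Lim_transform_eventually) (simp add: eventually_at_filter power2_eq_square)
    show "\<forall>\<^sub>F z in at ?p. norm (z - ?p) \<noteq> 0"
      by (simp add: eventually_at_filter)
  qed
  moreover have "g z \<ge> g ?p + (1 / \<mu>) *\<^sub>R (y - ?p) \<bullet> (z - ?p) + ?r z" for z
  proof -
    have "g ?p + (1 / \<mu>) *\<^sub>R (y - ?p) \<bullet> (z - ?p) + ?r z
        = g ?p + 1 / (2 * \<mu>) * (norm (?p - y))\<^sup>2 - 1 / (2 * \<mu>) * (norm (z - y))\<^sup>2"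
      using \<mu>_pos
      by (simp add: power2_norm_eq_inner inner_diff_left inner_diff_right inner_commute field_simps)
    then show ?thesis
      using prox_minimizes[of y z] by simp
  qed
  ultimately show ?thesis
    unfolding frechet_subdiff_def
    by (intro CollectI bexI[where x="?r"] always_eventually allI) blast+
qed

text \<open>The proximal point of \<open>y\<close> competes in the problem for \<open>y'\<close>;
  its objective value is a parabola in \<open>y'\<close>.\<close>

lemma moreau_env_upper_bound:
  "moreau_env \<mu> g y' \<le> moreau_env \<mu> g y + (1 / \<mu>) *\<^sub>R (y - prox \<mu> g y) \<bullet> (y' - y)
     + 1 / (2 * \<mu>) * (norm (y' - y))\<^sup>2"
proof -
  let ?p = "prox \<mu> g y"
  have "moreau_env \<mu> g y' \<le> prox_fun \<mu> g y' ?p"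
    by (rule moreau_env_le)
  also have "\<dots> = prox_fun \<mu> g y ?p + (1 / \<mu>) *\<^sub>R (y - ?p) \<bullet> (y' - y)
      + 1 / (2 * \<mu>) * (norm (y' - y))\<^sup>2"
    using \<mu>_pos
    by (simp add: power2_norm_eq_inner inner_diff_left inner_diff_right inner_commute field_simps)
  finally show ?thesis
    by (simp add: moreau_env_eq)
qed

section \<open>Consequences of weak convexity\<close>

context
  fixes \<rho> :: real
  assumes wc: "weakly_convex \<rho> g" and \<rho>_less: "\<rho> * \<mu> < 1"
begin

text \<open>At the midpoint of the minimizer and \<open>z\<close>, weak convexity costs
  \<open>\<rho> / 8\<close> and the proximal term gains \<open>1 / (8 * \<mu>)\<close> times the
  squared distance; doubling gives the factor \<open>1 / 4\<close>.\<close>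

lemma prox_growth:
  "prox_fun \<mu> g y (prox \<mu> g y) + (1 / \<mu> - \<rho>) / 4 * (norm (z - prox \<mu> g y))\<^sup>2 \<le> prox_fun \<mu> g y z"
proof -
  let ?p = "prox \<mu> g y"
  let ?m = "(1 / 2) *\<^sub>R ?p + (1 / 2) *\<^sub>R z"
  let ?G = "\<lambda>y. g y + \<rho> / 2 * (norm y)\<^sup>2"
  have "?G ?m \<le> 1 / 2 * ?G ?p + 1 / 2 * ?G z"
    using wc convex_onD[of UNIV ?G "1/2" ?p z] unfolding weakly_convex_def by simp
  moreover have "(norm ?m)\<^sup>2 = (norm ?p)\<^sup>2 / 2 + (norm z)\<^sup>2 / 2 - (norm (z - ?p))\<^sup>2 / 4"
    and q: "(norm (?m - y))\<^sup>2
      = (norm (?p - y))\<^sup>2 / 2 + (norm (z - y))\<^sup>2 / 2 - (norm (z - ?p))\<^sup>2 / 4"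
    by (simp_all add: power2_norm_eq_inner inner_diff_left inner_diff_right inner_add_left
        inner_add_right inner_commute field_simps)
  ultimately have "g ?m + \<rho> / 2 * ((norm ?p)\<^sup>2 / 2 + (norm z)\<^sup>2 / 2 - (norm (z - ?p))\<^sup>2 / 4)
      \<le> 1 / 2 * ?G ?p + 1 / 2 * ?G z"
    by metis
  then have "g ?m \<le> 1 / 2 * g ?p + 1 / 2 * g z + \<rho> / 8 * (norm (z - ?p))\<^sup>2"
    by (simp add: algebra_simps)
  moreover have "prox_fun \<mu> g y ?p \<le> prox_fun \<mu> g y ?m"
    by (rule prox_minimizes)
  ultimately have "prox_fun \<mu> g y ?p \<le> 1 / 2 * g ?p + 1 / 2 * g z + \<rho> / 8 * (norm (z - ?p))\<^sup>2
      + 1 / (2 * \<mu>) * ((norm (?p - y))\<^sup>2 / 2 + (norm (z - y))\<^sup>2 / 2 - (norm (z - ?p))\<^sup>2 / 4)"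
    unfolding q by linarith
  \<comment> \<open>Here \<open>i\<close> stands for \<open>1 / (2 * \<mu>)\<close>, which keeps
    division by \<open>\<mu>\<close> out of the algebra.\<close>
  moreover have "u + i * a + (2 * i - \<rho>) / 4 * d \<le> w + i * b"
    if "u + i * a \<le> 1 / 2 * u + 1 / 2 * w + \<rho> / 8 * d + i * (a / 2 + b / 2 - d / 4)"
    for u w i a b d
    using that by (simp add: field_simps)
  from this[where i="1 / (2 * \<mu>)"] have
    "u + 1 / (2 * \<mu>) * a + (1 / \<mu> - \<rho>) / 4 * d \<le> w + 1 / (2 * \<mu>) * b"
    if "u + 1 / (2 * \<mu>) * a \<le> 1 / 2 * u + 1 / 2 * w + \<rho> / 8 * d
      + 1 / (2 * \<mu>) * (a / 2 + b / 2 - d / 4)" for u w a b d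
    using that by simp
  ultimately show ?thesis
    by blast
qed

text \<open>Growth is applied at \<open>y\<close> and at \<open>y'\<close>, each with the other's
  proximal point as competitor; the values of \<open>g\<close> cancel in the sum, and Cauchy-Schwarz
  bounds what remains.\<close>

lemma prox_lipschitz: "norm (prox \<mu> g y' - prox \<mu> g y) \<le> 2 / (1 - \<rho> * \<mu>) * norm (y' - y)"
proof -
  let ?p = "prox \<mu> g y" and ?p' = "prox \<mu> g y'"
  let ?d = "norm (?p' - ?p)"
  define c i where "c = (1 / \<mu> - \<rho>) / 4 * ?d\<^sup>2" and "i = 1 / (2 * \<mu>)"
  have "2 * c \<le> i * ((norm (?p' - y))\<^sup>2 + (norm (?p - y'))\<^sup>2 - (norm (?p - y))\<^sup>2 - (norm (?p' - y'))\<^sup>2)"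
    using prox_growth[of y ?p'] prox_growth[of y' ?p]
    unfolding norm_minus_commute[of ?p ?p'] c_def[symmetric] i_def[symmetric]
      distrib_left right_diff_distrib
    by linarith
  also have "(norm (?p' - y))\<^sup>2 + (norm (?p - y'))\<^sup>2 - (norm (?p - y))\<^sup>2 - (norm (?p' - y'))\<^sup>2
      = 2 * ((?p' - ?p) \<bullet> (y' - y))"
    by (simp add: power2_norm_eq_inner inner_diff_left inner_diff_right inner_commute)
  also have "i * (2 * ((?p' - ?p) \<bullet> (y' - y))) = 1 / \<mu> * ((?p' - ?p) \<bullet> (y' - y))"
    by (simp add: i_def)
  also have "\<dots> \<le> 1 / \<mu> * (?d * norm (y' - y))"
    using \<mu>_pos by (intro mult_left_mono norm_cauchy_schwarz) simp
  finally have "2 * \<mu> * (2 * c) \<le> 2 * \<mu> * (1 / \<mu> * (?d * norm (y' - y)))"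
    using \<mu>_pos by (intro mult_left_mono) simp_all
  moreover have "2 * \<mu> * (2 * c) = ?d * ((1 - \<rho> * \<mu>) * ?d)"
  proof -
    have "\<mu> * (1 / \<mu> - \<rho>) = 1 - \<rho> * \<mu>"
      using \<mu>_pos by (simp add: right_diff_distrib)
    then show ?thesis
      by (simp add: c_def power2_eq_square)
  qed
  moreover have "2 * \<mu> * (1 / \<mu> * (?d * norm (y' - y))) = ?d * (2 * norm (y' - y))"
    using \<mu>_pos by simp
  ultimately have "?d * ((1 - \<rho> * \<mu>) * ?d) \<le> ?d * (2 * norm (y' - y))"
    by metis
  then have "(1 - \<rho> * \<mu>) * ?d \<le> 2 * norm (y' - y)"
    by (cases "?d = 0") (auto simp: mult_le_cancel_left)
  moreover have "0 < 1 - \<rho> * \<mu>"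
    using \<rho>_less by simp
  ultimately have "?d \<le> 2 * norm (y' - y) / (1 - \<rho> * \<mu>)"
    by (metis pos_le_divide_eq mult.commute)
  then show ?thesis
    by (metis times_divide_eq_left)
qed

text \<open>The parabola bound at \<open>y\<close> gives one side. Exchanging \<open>y\<close> and
  \<open>y'\<close> gives the other, with the slope at \<open>y'\<close> in place of that at
  \<open>y\<close>; by \<open>prox_lipschitz\<close> this replacement costs only a quadratic
  error.\<close>

lemma GDERIV_moreau_env: "GDERIV (moreau_env \<mu> g) y :> (1 / \<mu>) *\<^sub>R (y - prox \<mu> g y)"
proof -
  define c where "c = 2 / (1 - \<rho> * \<mu>)"
  \<comment> \<open>\<open>(1 + c) / \<mu>\<close> is a Lipschitz constant of \<open>v\<close>; the
    other summand is the curvature term of the parabola bound.\<close>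
  define K where "K = (1 + c) / \<mu> + 1 / (2 * \<mu>)"
  have "c \<ge> 0"
    using \<rho>_less by (simp add: c_def)
  define v where "v y = (1 / \<mu>) *\<^sub>R (y - prox \<mu> g y)" for y
  have "\<bar>moreau_env \<mu> g y' - moreau_env \<mu> g y - (y' - y) \<bullet> v y\<bar> \<le> K * (norm (y' - y))\<^sup>2"
    for y'
  proof -
    let ?e = "moreau_env \<mu> g" and ?n = "norm (y' - y)"
    have "?e y' \<le> ?e y + v y \<bullet> (y' - y) + 1 / (2 * \<mu>) * ?n\<^sup>2"
      unfolding v_def by (rule moreau_env_upper_bound)
    moreover have "1 / (2 * \<mu>) * ?n\<^sup>2 \<le> K * ?n\<^sup>2"
      using \<mu>_pos \<open>c \<ge> 0\<close> unfolding K_def by (intro mult_right_mono) auto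
    moreover have "?e y \<le> ?e y' + v y' \<bullet> (y - y') + 1 / (2 * \<mu>) * ?n\<^sup>2"
      using moreau_env_upper_bound[of y y'] by (simp add: v_def norm_minus_commute)
    moreover have "(v y - v y') \<bullet> (y' - y) \<le> (1 + c) / \<mu> * ?n\<^sup>2"
    proof -
      have "norm (v y - v y') = 1 / \<mu> * norm ((prox \<mu> g y' - prox \<mu> g y) - (y' - y))"
        using \<mu>_pos by (simp add: v_def algebra_simps flip: scaleR_diff_right)
      also have "\<dots> \<le> 1 / \<mu> * (c * ?n + ?n)"
        using \<mu>_pos prox_lipschitz[of y' y] norm_triangle_ineq4[of "prox \<mu> g y' - prox \<mu> g y" "y' - y"]
        unfolding c_def by (intro mult_left_mono) auto
      finally have "norm (v y - v y') * ?n \<le> 1 / \<mu> * (c * ?n + ?n) * ?n"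
        by (rule mult_right_mono) simp
      then show ?thesis
        using norm_cauchy_schwarz[of "v y - v y'" "y' - y"]
        by (simp add: algebra_simps power2_eq_square add_divide_distrib)
    qed
    moreover have "v y' \<bullet> (y - y') = - (v y' \<bullet> (y' - y))" "(y' - y) \<bullet> v y = v y \<bullet> (y' - y)"
      "(v y - v y') \<bullet> (y' - y) = v y \<bullet> (y' - y) - v y' \<bullet> (y' - y)"
      by (simp_all add: inner_diff_left inner_diff_right inner_commute)
    moreover have "K * ?n\<^sup>2 = (1 + c) / \<mu> * ?n\<^sup>2 + 1 / (2 * \<mu>) * ?n\<^sup>2"
      by (simp only: K_def distrib_right)
    ultimately show ?thesis
      by linarith
  qed
  then show ?thesis
    unfolding v_def by (rule GDERIV_quadratic_bound)
qed

end

end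

text \<open>The proximal point for \<open>\<mu>\<close> competes in the problem for
  \<open>\<mu>'\<close>. Its distance to \<open>y\<close> is at most \<open>2 * \<mu> * L\<close>
  and \<open>\<mu> / \<mu>' \<le> 2\<close>, so the extra cost is a multiple of
  \<open>\<mu> - \<mu>'\<close>, which telescopes.\<close>

lemma moreau_env_decrease:
  fixes g :: "'a::euclidean_space \<Rightarrow> real"
  assumes lip: "L-lipschitz_on UNIV g" and \<mu>: "0 < \<mu>'" "\<mu>' \<le> \<mu>" "\<mu> \<le> 2 * \<mu>'"
  shows "moreau_env \<mu>' g y \<le> moreau_env \<mu> g y + 4 * L\<^sup>2 * (\<mu> - \<mu>')"
proof -
  let ?p = "prox \<mu> g y"
  have \<mu>_pos: "0 < \<mu>"
    using \<mu> by simp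
  have "moreau_env \<mu>' g y \<le> prox_fun \<mu>' g y ?p"
    using moreau_env_le[OF lip] \<mu> by blast
  also have "\<dots> = moreau_env \<mu> g y + (\<mu> - \<mu>') / (2 * \<mu> * \<mu>') * (norm (y - ?p))\<^sup>2"
    using \<mu> \<mu>_pos by (simp add: moreau_env_eq[OF lip \<mu>_pos] norm_minus_commute field_simps)
  also have "(\<mu> - \<mu>') / (2 * \<mu> * \<mu>') * (norm (y - ?p))\<^sup>2
      \<le> (\<mu> - \<mu>') / (2 * \<mu> * \<mu>') * (2 * \<mu> * L)\<^sup>2"
    using \<mu> \<mu>_pos norm_prox_diff_le[OF lip \<mu>_pos] by (intro mult_left_mono power_mono) auto
  also have "\<dots> = 2 * L\<^sup>2 * (\<mu> - \<mu>') * (\<mu> / \<mu>')"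
    using \<mu> \<mu>_pos by (simp add: field_simps power2_eq_square)
  also have "\<dots> \<le> 2 * L\<^sup>2 * (\<mu> - \<mu>') * 2"
  proof (rule mult_left_mono)
    show "\<mu> / \<mu>' \<le> 2"
      using \<mu> by (simp add: divide_le_eq)
    show "0 \<le> 2 * L\<^sup>2 * (\<mu> - \<mu>')"
      using \<mu> by simp
  qed
  finally show ?thesis
    by simp
qed

section \<open>The iteration\<close>

lemma vs_mu_pos: "\<rho> > 0 \<Longrightarrow> k \<ge> 1 \<Longrightarrow> vs_mu \<rho> k > 0"
  by (simp add: vs_mu_def)

lemma vs_mu_antimono: "\<rho> > 0 \<Longrightarrow> 1 \<le> i \<Longrightarrow> i \<le> k \<Longrightarrow> vs_mu \<rho> k \<le> vs_mu \<rho> i"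
  unfolding vs_mu_def by (intro mult_left_mono powr_mono2') auto

text \<open>The largest parameter is \<open>vs_mu \<rho> 1 = 1 / (2 * \<rho>)\<close>.\<close>

lemma vs_mu_le: "\<rho> > 0 \<Longrightarrow> k \<ge> 1 \<Longrightarrow> \<rho> * vs_mu \<rho> k < 1"
  using vs_mu_antimono[of \<rho> 1 k] by (simp add: vs_mu_def field_simps)

lemma vs_mu_eq: "vs_mu \<rho> k = 1 / (2 * \<rho> * real k powr (1 / 3))"
  by (simp add: vs_mu_def powr_minus_divide)

text \<open>This crude factor serves both the passage from \<open>k\<close> to \<open>Suc k\<close>
  and the blocks from \<open>K\<close> to \<open>2 * K\<close>.\<close>

lemma powr_third_double_le: "(2 * x) powr (1 / 3) \<le> 2 * x powr (1 / 3)" if "0 \<le> x" for x :: real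
proof -
  have "(2::real) powr (1 / 3) \<le> 2 powr 1"
    by (intro powr_mono) auto
  then show ?thesis
    using that by (simp add: powr_mult mult_right_mono)
qed

lemma vs_mu_Suc_ge:
  assumes "\<rho> > 0" "k \<ge> 1"
  shows "vs_mu \<rho> k \<le> 2 * vs_mu \<rho> (Suc k)"
proof -
  have "real (Suc k) powr (1 / 3) \<le> (2 * real k) powr (1 / 3)"
    using assms by (intro powr_mono2) auto
  also have "\<dots> \<le> 2 * real k powr (1 / 3)"
    by (rule powr_third_double_le) simp
  finally have "1 / (2 * real k powr (1 / 3)) \<le> 1 / real (Suc k) powr (1 / 3)"
    using assms by (intro divide_left_mono) auto
  then have "1 / \<rho> * (1 / (2 * real k powr (1 / 3))) \<le> 1 / \<rho> * (1 / real (Suc k) powr (1 / 3))"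
    using assms by (intro mult_left_mono) auto
  then show ?thesis
    by (simp add: vs_mu_eq mult.commute mult.left_commute)
qed

lemma inner_transpose_mult: "(A *v x) \<bullet> y = x \<bullet> (transpose A *v y)" for A :: "real^'d^'n"
  by (metis dot_lmul_matrix inner_commute transpose_matrix_vector)

text \<open>The hypotheses of the theorem except finiteness of the limit inferior, which enters only
  in \<open>accepted_early\<close>.\<close>

locale variable_smoothing =
  fixes h :: "real^'d \<Rightarrow> real" and g :: "real^'n \<Rightarrow> real" and A :: "real^'d^'n"
    and \<rho> Lh Lg :: real and x1 :: "real^'d"
  assumes h_diff: "h differentiable (at u)"
    and h_lip: "Lh-lipschitz_on UNIV (grad h)"
    and \<rho>_pos: "\<rho> > 0"
    and g_wc: "weakly_convex \<rho> g"
    and g_lip: "Lg-lipschitz_on UNIV g"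
    and A_nonzero: "A \<noteq> 0"
begin

abbreviation "X \<equiv> vs_iter h g A \<rho> Lh x1"
abbreviation "F \<equiv> vs_F h g A \<rho>"
abbreviation "L \<equiv> vs_L A \<rho> Lh"
abbreviation "\<gamma> \<equiv> vs_gamma A \<rho> Lh"
abbreviation "\<mu> \<equiv> vs_mu \<rho>"
abbreviation "Z k x \<equiv> prox (\<mu> k) g (A *v x)"
text \<open>The gradient of the envelope at \<open>A *v x\<close> and at the same time a subgradient
  of \<open>g\<close> at \<open>Z k x\<close>.\<close>

abbreviation "V k x \<equiv> (1 / \<mu> k) *\<^sub>R (A *v x - Z k x)"

lemma onorm_A_pos: "0 < onorm ((*v) A)"
  using A_nonzero by (metis matrix_eq matrix_vector_mul_bounded_linear matrix_vector_mult_0 onorm_pos_lt)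

lemma Lh_nonneg: "0 \<le> Lh"
  using h_lip lipschitz_on_nonneg by blast

lemma Lg_nonneg: "0 \<le> Lg"
  using g_lip lipschitz_on_nonneg by blast

lemma L_pos: "k \<ge> 1 \<Longrightarrow> 0 < L k"
  unfolding vs_L_def using Lh_nonneg onorm_A_pos vs_mu_pos[OF \<rho>_pos] by (simp add: add_nonneg_pos)

text \<open>\<open>1 / \<mu> k\<close> is \<open>2 * \<rho>\<close> times the cube root of
  \<open>k\<close>; this root is at least 1 and so absorbs \<open>Lh\<close>.\<close>

lemma L_le:
  assumes "k \<ge> 1"
  shows "L k \<le> (Lh + 2 * \<rho> * (onorm ((*v) A))\<^sup>2) * real k powr (1 / 3)"
proof -
  have "1 \<le> real k powr (1 / 3)"
    using assms by (intro ge_one_powr_ge_zero) auto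
  then have "Lh * 1 \<le> Lh * real k powr (1 / 3)"
    using Lh_nonneg by (intro mult_left_mono)
  then show ?thesis
    by (simp add: vs_L_def vs_mu_eq algebra_simps)
qed

lemma grad_F:
  assumes "k \<ge> 1"
  shows "grad (F k) x = grad h x + transpose A *v V k x"
proof (rule grad_eqI)
  have "GDERIV (moreau_env (\<mu> k) g) (A *v x) :> V k x"
    using GDERIV_moreau_env[OF g_lip _ g_wc] vs_mu_pos vs_mu_le \<rho>_pos assms by blast
  then have "((\<lambda>x. moreau_env (\<mu> k) g (A *v x)) has_derivative (\<lambda>u. (A *v u) \<bullet> V k x)) (at x)"
    unfolding gderiv_def
    by (rule has_derivative_compose[OF bounded_linear_imp_has_derivative[OF matrix_vector_mul_bounded_linear]])
  then have "GDERIV (\<lambda>x. moreau_env (\<mu> k) g (A *v x)) x :> transpose A *v V k x"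
    unfolding gderiv_def inner_transpose_mult .
  then show "GDERIV (F k) x :> grad h x + transpose A *v V k x"
    unfolding vs_F_def by (intro GDERIV_add GDERIV_grad h_diff)
qed

text \<open>The curvature \<open>Lh\<close> of \<open>h\<close> and the curvature
  \<open>1 / \<mu> k\<close> of the envelope, scaled by the squared norm of \<open>A\<close>, add up
  to exactly \<open>L k\<close>.\<close>

lemma F_upper_bound:
  assumes "k \<ge> 1"
  shows "F k y \<le> F k x + grad (F k) x \<bullet> (y - x) + L k / 2 * (norm (y - x))\<^sup>2"
proof -
  let ?a = "onorm ((*v) A)"
  have \<mu>k: "0 < \<mu> k"
    using vs_mu_pos[OF \<rho>_pos assms] .
  have "h y \<le> h x + grad h x \<bullet> (y - x) + Lh / 2 * (norm (y - x))\<^sup>2"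
    using descent_lemma[OF GDERIV_grad[OF h_diff] h_lip] .
  moreover have "moreau_env (\<mu> k) g (A *v y) \<le> moreau_env (\<mu> k) g (A *v x)
      + V k x \<bullet> (A *v (y - x)) + 1 / (2 * \<mu> k) * (norm (A *v (y - x)))\<^sup>2"
    using moreau_env_upper_bound[OF g_lip \<mu>k, of "A *v y" "A *v x"]
    by (simp add: matrix_vector_mult_diff_distrib)
  moreover have "1 / (2 * \<mu> k) * (norm (A *v (y - x)))\<^sup>2 \<le> 1 / (2 * \<mu> k) * (?a * norm (y - x))\<^sup>2"
    using \<mu>k onorm[OF matrix_vector_mul_bounded_linear, of A "y - x"]
    by (intro mult_left_mono power_mono) auto
  moreover have "1 / (2 * \<mu> k) * (?a * norm (y - x))\<^sup>2 + Lh / 2 * (norm (y - x))\<^sup>2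
      = L k / 2 * (norm (y - x))\<^sup>2"
    using \<mu>k by (simp add: vs_L_def power_mult_distrib add_divide_distrib distrib_right)
  moreover have "grad (F k) x \<bullet> (y - x) = grad h x \<bullet> (y - x) + V k x \<bullet> (A *v (y - x))"
    using inner_transpose_mult[of A "y - x" "V k x"]
    unfolding grad_F[OF assms] inner_add_left by (metis inner_commute)
  ultimately show ?thesis
    unfolding vs_F_def by linarith
qed

section \<open>Descent along the iterates\<close>

lemma X_Suc: "k \<ge> 1 \<Longrightarrow> X (Suc k) = X k - \<gamma> k *\<^sub>R grad (F k) (X k)"
  by (cases k) (simp_all add: Let_def)

text \<open>With step size \<open>1 / L k\<close> the quadratic term takes back half of the linear
  gain.\<close>

lemma F_step:
  assumes "k \<ge> 1"
  shows "F k (X (Suc k)) \<le> F k (X k) - \<gamma> k / 2 * (norm (grad (F k) (X k)))\<^sup>2"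
proof -
  let ?G = "grad (F k) (X k)"
  have "F k (X (Suc k)) \<le> F k (X k) + ?G \<bullet> (- (\<gamma> k *\<^sub>R ?G)) + L k / 2 * (norm (- (\<gamma> k *\<^sub>R ?G)))\<^sup>2"
    using F_upper_bound[OF assms, of "X (Suc k)" "X k"] by (simp add: X_Suc[OF assms])
  also have "\<dots> = F k (X k) - \<gamma> k * (norm ?G)\<^sup>2 + L k * \<gamma> k * (\<gamma> k / 2 * (norm ?G)\<^sup>2)"
    by (simp add: power2_norm_eq_inner[symmetric] power_mult_distrib) (simp add: power2_eq_square)
  also have "L k * \<gamma> k = 1"
    using L_pos[OF assms] by (simp add: vs_gamma_def)
  finally show ?thesis
    by simp
qed

text \<open>Adding a multiple of \<open>\<mu> k\<close> absorbs the increase of the Moreau envelope when the smoothing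
  parameter shrinks, so that this potential is decreasing along the iteration.\<close>

definition potential :: "nat \<Rightarrow> real" where
  "potential k = F k (X k) + 4 * Lg\<^sup>2 * \<mu> k"

lemma potential_Suc:
  assumes "k \<ge> 1"
  shows "potential (Suc k) \<le> potential k - \<gamma> k / 2 * (norm (grad (F k) (X k)))\<^sup>2"
proof -
  have "F (Suc k) (X (Suc k)) \<le> F k (X (Suc k)) + 4 * Lg\<^sup>2 * (\<mu> k - \<mu> (Suc k))"
    unfolding vs_F_def
    using moreau_env_decrease[OF g_lip] vs_mu_pos[OF \<rho>_pos] vs_mu_antimono[OF \<rho>_pos]
      vs_mu_Suc_ge[OF \<rho>_pos assms] assms by simp
  then show ?thesis
    using F_step[OF assms] by (simp add: potential_def right_diff_distrib)
qed

lemma \<gamma>_pos: "k \<ge> 1 \<Longrightarrow> 0 < \<gamma> k"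
  using L_pos by (simp add: vs_gamma_def)

lemma potential_antimono:
  assumes "1 \<le> i" "i \<le> k"
  shows "potential k \<le> potential i"
  using assms(2)
proof (induction k rule: dec_induct)
  case (step n)
  then have "0 \<le> \<gamma> n / 2 * (norm (grad (F n) (X n)))\<^sup>2"
    using \<gamma>_pos[of n] assms by simp
  then show ?case
    using step potential_Suc[of n] assms by simp
qed simp

text \<open>Potentials decrease and dominate \<open>F n (X n)\<close>. A finite limit inferior thus
  limits the total decrease.\<close>

lemma liminf_le_potential:
  assumes "1 \<le> k"
  shows "liminf (\<lambda>k. ereal (F k (X k))) \<le> potential k"
proof (rule Liminf_le)
  have "F n (X n) \<le> potential k" if "n \<ge> k" for n
  proof -
    have "0 \<le> 4 * Lg\<^sup>2 * \<mu> n"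
      using vs_mu_pos[OF \<rho>_pos, of n] assms that by simp
    then show ?thesis
      using potential_antimono[OF assms that] unfolding potential_def by linarith
  qed
  then show "\<forall>\<^sub>F n in sequentially. ereal (F n (X n)) \<le> ereal (potential k)"
    by (auto simp: eventually_sequentially)
qed simp

section \<open>Stopping test, runs and iteration count\<close>

definition accepted :: "real \<Rightarrow> nat \<Rightarrow> bool" where
  "accepted \<epsilon> k \<longleftrightarrow> norm (grad (F k) (X k)) \<le> \<epsilon> \<and> norm (A *v X k - Z k (X k)) \<le> \<epsilon>"

text \<open>The subgradient \<open>V k (X k)\<close> yields an element of the set whose distance is
  exactly the norm of the gradient of \<open>F k\<close>.\<close>

lemma accepted_dist:
  assumes "accepted \<epsilon> k" "k \<ge> 1"
  shows "edist_to (- grad h (X k)) ((*v) (transpose A) ` frechet_subdiff g (Z k (X k))) \<le> ereal \<epsilon>"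
proof -
  have "V k (X k) \<in> frechet_subdiff g (Z k (X k))"
    using prox_subgradient[OF g_lip vs_mu_pos[OF \<rho>_pos assms(2)]] .
  then have "edist_to (- grad h (X k)) ((*v) (transpose A) ` frechet_subdiff g (Z k (X k)))
      \<le> ereal (dist (- grad h (X k)) (transpose A *v V k (X k)))"
    unfolding edist_to_def by (intro INF_lower) blast
  also have "dist (- grad h (X k)) (transpose A *v V k (X k)) = norm (grad (F k) (X k))"
    using norm_minus_cancel[of "grad (F k) (X k)"] by (simp add: grad_F[OF assms(2)] dist_norm)
  finally show ?thesis
    using assms(1) unfolding accepted_def by (meson ereal_less_eq(3) order_trans)
qed

text \<open>If the epoch is exhausted, the next one is entered with the same \<open>k\<close>.
  Stopping requires a comparison with \<open>S\<close> besides \<open>accepted\<close>, hence only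
  an implication from \<open>stop\<close>.\<close>

lemma run_continues:
  assumes run: "vs_run h g A \<rho> Lh x1 \<epsilon> l k S j False" and k: "k \<le> 2 ^ (l + 1)"
  shows "\<exists>l S j stop. vs_run h g A \<rho> Lh x1 \<epsilon> l (Suc k) S j stop
    \<and> Suc k \<le> 2 ^ (l + 1) \<and> (stop \<longrightarrow> accepted \<epsilon> (Suc k))"
proof -
  obtain l' S' j' where run': "vs_run h g A \<rho> Lh x1 \<epsilon> l' k S' j' False" and k': "k < 2 ^ (l' + 1)"
  proof (cases "k = 2 ^ (l + 1)")
    case True
    then show ?thesis
      using that vs_run.next_epoch[OF run True] by simp
  next
    case False
    then show ?thesis
      using that run k by simp
  qed
  let ?N = "norm (grad (F (k + 1)) (X (k + 1)))"
  show ?thesis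
  proof (cases "ereal ?N \<le> S'")
    case True
    show ?thesis
      using vs_run.improve[OF run' k' refl refl True refl] k' unfolding accepted_def by fastforce
  next
    case False
    show ?thesis
      using vs_run.no_improve[OF run' k' refl refl False] k' by fastforce
  qed
qed

text \<open>Stopping forces acceptance, so the run goes on. Indices start at 2 because the first
  iterate is never tested.\<close>

lemma run_reaches:
  assumes "1 \<le> k" and "\<And>i. 2 \<le> i \<Longrightarrow> i \<le> k \<Longrightarrow> \<not> accepted \<epsilon> i"
  shows "\<exists>l S j. vs_run h g A \<rho> Lh x1 \<epsilon> l k S j False \<and> k \<le> 2 ^ (l + 1)"
  using assms
proof (induction k rule: dec_induct)
  case base
  then show ?case
    using vs_run.start by fastforce
next
  case (step n)
  then obtain l S j where "vs_run h g A \<rho> Lh x1 \<epsilon> l n S j False" "n \<le> 2 ^ (l + 1)"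
    by (metis le_SucI)
  then obtain l S j stop where "vs_run h g A \<rho> Lh x1 \<epsilon> l (Suc n) S j stop"
    "Suc n \<le> 2 ^ (l + 1)" "stop \<longrightarrow> accepted \<epsilon> (Suc n)"
    using run_continues by blast
  moreover have "\<not> accepted \<epsilon> (Suc n)"
    using step by simp
  ultimately show ?case
    by (metis (full_types))
qed

text \<open>The run is unstopped at \<open>k - 1\<close> and makes one more step, whether or not it
  then stops.\<close>

lemma generates_first_accepted:
  assumes "2 \<le> k" and "\<And>i. 2 \<le> i \<Longrightarrow> i < k \<Longrightarrow> \<not> accepted \<epsilon> i"
  shows "vs_generates h g A \<rho> Lh x1 \<epsilon> k"
proof -
  obtain n where n: "k = Suc n" "1 \<le> n"
    using assms(1) by (cases k) auto
  then obtain l S j where "vs_run h g A \<rho> Lh x1 \<epsilon> l n S j False" "n \<le> 2 ^ (l + 1)"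
    using run_reaches[of n] assms(2) by fastforce
  then show ?thesis
    unfolding vs_generates_def n using run_continues by blast
qed

text \<open>If the whole block were rejected, its \<open>K\<close> steps would lower the potential
  by more than \<open>potential 1 - B\<close>. The constant \<open>c\<close> serves two purposes:
  \<open>Lg / \<rho> \<le> c\<close> handles the proximal distance, the bound on its square the
  total drop.\<close>

lemma accepted_in_block:
  fixes c M B :: real
  defines "M \<equiv> Lh + 2 * \<rho> * (onorm ((*v) A))\<^sup>2"
  assumes bound: "\<And>k. 1 \<le> k \<Longrightarrow> B \<le> potential k"
    and c: "Lg / \<rho> \<le> c" "4 * M * (potential 1 - B) < c\<^sup>2" "0 < c"
    and \<epsilon>: "0 < \<epsilon>" and K: "1 \<le> K" "(c / \<epsilon>) ^ 3 \<le> real K"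
  shows "\<exists>k\<in>{K..<2 * K}. accepted \<epsilon> k"
proof (rule ccontr)
  assume contra: "\<not> (\<exists>k\<in>{K..<2 * K}. accepted \<epsilon> k)"
  \<comment> \<open>In terms of the cube root \<open>s\<close> the size condition on
    \<open>K\<close> reads \<open>c \<le> s * \<epsilon>\<close>.\<close>
  define s where "s = real K powr (1 / 3)"
  have s_pos: "0 < s"
    using K by (simp add: s_def)
  have s3: "s ^ 3 = real K"
    using K by (simp add: s_def powr_powr flip: powr_realpow)
  have "c / \<epsilon> \<le> s"
  proof (rule power_le_imp_le_base[of _ 2])
    show "(c / \<epsilon>) ^ Suc 2 \<le> s ^ Suc 2"
      using K s3 by (simp add: numeral_eq_Suc)
  qed (use s_pos in simp)
  then have c_le: "c \<le> s * \<epsilon>"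
    using \<epsilon> by (simp add: field_simps)
  have M_pos: "0 < M"
    unfolding M_def using Lh_nonneg \<rho>_pos onorm_A_pos by (simp add: add_nonneg_pos)
  \<comment> \<open>On the block \<open>\<gamma> k\<close> is at least
    \<open>1 / (2 * M * s)\<close>; half of this times the squared tolerance is
    \<open>\<delta>\<close>.\<close>
  define \<delta> where "\<delta> = \<epsilon>\<^sup>2 / (4 * M * s)"
  have drop: "potential (Suc k) \<le> potential k - \<delta>" if k: "K \<le> k" "k < 2 * K" for k
  proof -
    have k1: "1 \<le> k"
      using k K by simp
    \<comment> \<open>The proximal test holds on the whole block, so a rejection must come from the
      gradient.\<close>
    have "norm (A *v X k - Z k (X k)) \<le> 2 * \<mu> k * Lg"
      using norm_prox_diff_le[OF g_lip vs_mu_pos[OF \<rho>_pos k1]] .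
    also have "\<dots> \<le> 2 * \<mu> K * Lg"
      using vs_mu_antimono[OF \<rho>_pos K(1) k(1)] Lg_nonneg by (simp add: mult_right_mono)
    also have "\<dots> = Lg / \<rho> / s"
      by (simp add: vs_mu_eq s_def)
    also have "\<dots> \<le> s * \<epsilon> / s"
      using c(1) c_le s_pos by (intro divide_right_mono) auto
    also have "\<dots> = \<epsilon>"
      using s_pos by simp
    finally have "norm (A *v X k - Z k (X k)) \<le> \<epsilon>" .
    then have "\<epsilon> < norm (grad (F k) (X k))"
      using contra k unfolding accepted_def by (meson atLeastLessThan_iff not_le)
    then have "\<epsilon>\<^sup>2 \<le> (norm (grad (F k) (X k)))\<^sup>2"
      using \<epsilon> by (intro power_mono) auto
    moreover have "1 / (2 * M * s) \<le> \<gamma> k"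
    proof -
      have "L k \<le> M * real k powr (1 / 3)"
        unfolding M_def by (rule L_le[OF k1])
      also have "\<dots> \<le> M * (2 * s)"
      proof -
        have "real k powr (1 / 3) \<le> (2 * real K) powr (1 / 3)"
          using k by (intro powr_mono2) auto
        also have "\<dots> \<le> 2 * s"
          unfolding s_def by (rule powr_third_double_le) simp
        finally show ?thesis
          using M_pos by simp
      qed
      finally show ?thesis
        unfolding vs_gamma_def using L_pos[OF k1] M_pos s_pos
        by (intro divide_left_mono) (auto simp: mult.commute mult.left_commute)
    qed
    ultimately have "1 / (2 * M * s) / 2 * \<epsilon>\<^sup>2 \<le> \<gamma> k / 2 * (norm (grad (F k) (X k)))\<^sup>2"
      using \<gamma>_pos[OF k1] by (intro mult_mono) auto
    then show ?thesis
      using potential_Suc[OF k1] by (simp add: \<delta>_def)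
  qed
  have "potential (K + m) \<le> potential K - real m * \<delta>" if "m \<le> K" for m
    using that
  proof (induction m)
    case (Suc m)
    then show ?case
      using drop[of "K + m"] by (simp add: algebra_simps)
  qed simp
  from this[of K] have "real K * \<delta> \<le> potential 1 - B"
    using bound[of "K + K"] potential_antimono[of 1 K] K by simp
  \<comment> \<open>Writing \<open>K\<close> as \<open>s ^ 3\<close> cancels one \<open>s\<close>,
    leaving the square that is compared with that of \<open>c\<close>.\<close>
  moreover have "real K * \<delta> = (s * \<epsilon>)\<^sup>2 / (4 * M)"
    using s_pos unfolding s3[symmetric] \<delta>_def by (simp add: field_simps power2_eq_square power3_eq_cube)
  ultimately have "(s * \<epsilon>)\<^sup>2 \<le> 4 * M * (potential 1 - B)"
    using M_pos by (simp add: pos_divide_le_eq mult.commute)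
  moreover have "c\<^sup>2 \<le> (s * \<epsilon>)\<^sup>2"
    using c c_le by (intro power_mono) auto
  ultimately show False
    using c by linarith
qed

lemma accepted_early:
  assumes fin: "\<bar>liminf (\<lambda>k. ereal (F k (X k)))\<bar> \<noteq> \<infinity>"
  obtains C where "\<And>\<epsilon>. 0 < \<epsilon> \<Longrightarrow> \<exists>k\<ge>2. accepted \<epsilon> k \<and> real k \<le> C / \<epsilon> ^ 3 + 6"
proof -
  obtain B where B: "liminf (\<lambda>k. ereal (F k (X k))) = ereal B"
    using fin by auto
  have bound: "B \<le> potential k" if "1 \<le> k" for k
    using liminf_le_potential[OF that] B by simp
  define D where "D = 4 * (Lh + 2 * \<rho> * (onorm ((*v) A))\<^sup>2) * (potential 1 - B)"
  \<comment> \<open>All summands are nonnegative; the final 1 gives \<open>1 \<le> c\<close>, so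
    that \<open>D < c\<close> implies that \<open>D\<close> is below the square of
    \<open>c\<close>.\<close>
  define c where "c = Lg / \<rho> + D + 1"
  have "0 \<le> D"
    unfolding D_def using bound[of 1] Lh_nonneg \<rho>_pos by simp
  moreover have "0 \<le> Lg / \<rho>"
    using Lg_nonneg \<rho>_pos by simp
  ultimately have c: "Lg / \<rho> \<le> c" "D < c" "1 \<le> c"
    unfolding c_def by linarith+
  then have "D < c\<^sup>2"
    by (smt (verit) mult_le_cancel_left1 power2_eq_square)
  have "\<exists>k\<ge>2. accepted \<epsilon> k \<and> real k \<le> 2 * c ^ 3 / \<epsilon> ^ 3 + 6" if \<epsilon>: "0 < \<epsilon>" for \<epsilon>
  proof -
    \<comment> \<open>The added 2 makes every index of the block at least 2. Rounding costs at most
      1 more, which doubles to the 6 in the bound.\<close>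
    define K where "K = nat \<lceil>(c / \<epsilon>) ^ 3\<rceil> + 2"
    have pos: "0 \<le> (c / \<epsilon>) ^ 3"
      using c \<epsilon> by simp
    then have K: "(c / \<epsilon>) ^ 3 \<le> real K" "real K \<le> (c / \<epsilon>) ^ 3 + 3" "2 \<le> K"
      unfolding K_def by linarith+
    obtain k where "k \<in> {K..<2 * K}" "accepted \<epsilon> k"
      using accepted_in_block[OF bound c(1) _ _ \<epsilon> _ K(1)] \<open>D < c\<^sup>2\<close> c K(3) unfolding D_def by fastforce
    moreover from this have "real k \<le> 2 * real K"
      by simp
    then have "real k \<le> 2 * c ^ 3 / \<epsilon> ^ 3 + 6"
      using K(2) by (simp add: power_divide)
    ultimately show ?thesis
      using K(3) by (metis atLeastLessThan_iff order_trans)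
  qed
  then show ?thesis
    using that by blast
qed

end

theorem theorem4p2:
  fixes h :: "real^'d \<Rightarrow> real" and g :: "real^'n \<Rightarrow> real" and A :: "real^'d^'n"
    and \<rho> Lh Lg :: real and x1 :: "real^'d"
  assumes "\<forall>u. h differentiable (at u)"
    and "Lh-lipschitz_on UNIV (grad h)"
    and "\<rho> > 0"
    and "weakly_convex \<rho> g"
    and "Lg-lipschitz_on UNIV g"
    and "A \<noteq> 0"
    and "\<bar>liminf (\<lambda>k. ereal (vs_F h g A \<rho> k (vs_iter h g A \<rho> Lh x1 k)))\<bar> \<noteq> \<infinity>"
  shows "\<exists>j :: real \<Rightarrow> nat.
      (\<forall>\<epsilon>>0. vs_generates h g A \<rho> Lh x1 \<epsilon> (j \<epsilon>) \<and>
         (let x = vs_iter h g A \<rho> Lh x1 (j \<epsilon>); z = prox (vs_mu \<rho> (j \<epsilon>)) g (A *v x)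
          in edist_to (- grad h x) ((*v) (transpose A) ` frechet_subdiff g z) \<le> ereal \<epsilon> \<and>
             norm (A *v x - z) \<le> \<epsilon>)) \<and>
      (\<lambda>\<epsilon>. real (j \<epsilon>)) \<in> O[at_right 0](\<lambda>\<epsilon>. 1 / \<epsilon> ^ 3)"
proof -
  interpret variable_smoothing h g A \<rho> Lh Lg x1
    using assms by unfold_locales auto
  obtain C where C: "\<And>\<epsilon>. 0 < \<epsilon> \<Longrightarrow> \<exists>k\<ge>2. accepted \<epsilon> k \<and> real k \<le> C / \<epsilon> ^ 3 + 6"
    using accepted_early[OF assms(7)] by blast
  \<comment> \<open>The first accepted index is taken since the run is known to continue only up to
    there.\<close>
  define j where "j \<epsilon> = (LEAST k. 2 \<le> k \<and> accepted \<epsilon> k)" for \<epsilon>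
  have j: "2 \<le> j \<epsilon>" "accepted \<epsilon> (j \<epsilon>)" "real (j \<epsilon>) \<le> C / \<epsilon> ^ 3 + 6" if \<epsilon>: "0 < \<epsilon>" for \<epsilon>
  proof -
    obtain k where k: "2 \<le> k" "accepted \<epsilon> k" "real k \<le> C / \<epsilon> ^ 3 + 6"
      using C[OF \<epsilon>] by blast
    then show "2 \<le> j \<epsilon>" "accepted \<epsilon> (j \<epsilon>)"
      unfolding j_def using LeastI[of "\<lambda>k. 2 \<le> k \<and> accepted \<epsilon> k" k] by blast+
    have "j \<epsilon> \<le> k"
      unfolding j_def using k by (intro Least_le) blast
    then show "real (j \<epsilon>) \<le> C / \<epsilon> ^ 3 + 6"
      using k(3) by linarith
  qed
  have least: "\<not> accepted \<epsilon> i" if "2 \<le> i" "i < j \<epsilon>" for \<epsilon> i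
    using not_less_Least[of i "\<lambda>k. 2 \<le> k \<and> accepted \<epsilon> k"] that unfolding j_def by blast
  have "(\<lambda>\<epsilon>. real (j \<epsilon>)) \<in> O[at_right 0](\<lambda>\<epsilon>. 1 / \<epsilon> ^ 3)"
  proof (rule bigoI)
    \<comment> \<open>For tolerances below 1 the additive 6 is absorbed into the cubic term.\<close>
    have "norm (real (j \<epsilon>)) \<le> (C + 6) * norm (1 / \<epsilon> ^ 3)" if "0 < \<epsilon>" "\<epsilon> < 1" for \<epsilon>
    proof -
      have "6 \<le> 6 / \<epsilon> ^ 3"
        using that by (simp add: pos_le_divide_eq power_le_one)
      then show ?thesis
        using j(3)[OF that(1)] that by (simp add: add_divide_distrib)
    qed
    then show "\<forall>\<^sub>F \<epsilon> in at_right 0. norm (real (j \<epsilon>)) \<le> (C + 6) * norm (1 / \<epsilon> ^ 3)"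
      unfolding eventually_at_right_field by (intro exI[of _ 1]) simp
  qed
  moreover have "vs_generates h g A \<rho> Lh x1 \<epsilon> (j \<epsilon>)" if "0 < \<epsilon>" for \<epsilon>
    using generates_first_accepted j(1)[OF that] least by blast
  moreover have "edist_to (- grad h (X (j \<epsilon>)))
      ((*v) (transpose A) ` frechet_subdiff g (Z (j \<epsilon>) (X (j \<epsilon>)))) \<le> ereal \<epsilon>" if "0 < \<epsilon>" for \<epsilon>
    using accepted_dist j[OF that] by simp
  moreover have "norm (A *v X (j \<epsilon>) - Z (j \<epsilon>) (X (j \<epsilon>))) \<le> \<epsilon>" if "0 < \<epsilon>" for \<epsilon>
    using j(2)[OF that] unfolding accepted_def by blast
  ultimately show ?thesis
    unfolding Let_def by blast
qed

end
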